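(* Let $\lambda_1,\lambda_2,c_1,c_2>0$ and $\alpha\in[0,1]$, let $\{D(t):t\geq 0\}$ be the damped telegraph process with parameters $(\lambda_1,\lambda_2,c_1,c_2,\alpha)$, and let $Q_D:=\sup\{D(t):t\geq 0\}$. Assume that $\lambda_2c_1-\lambda_1c_2<0$. Then $$\lim_{q\to\infty}\frac{1}{q}\log P(Q_D>q)=-\frac{\lambda_1}{c_1}.$$
   Context: Damped telegraph process. Fix $\lambda_1,\lambda_2,c_1,c_2>0$ and $\alpha\in[0,1]$. Let $V(0)$ be a random variable with $P(V(0)=c_1)=\alpha$ and $P(V(0)=-c_2)=1-\alpha$. Let $\{\tau_n:n\geq 1\}$ be random variables which are conditionally independent given $V(0)$, with the following conditional distributions: - if $V(0)=c_1$, then for all $k\geq 1$, $\tau_{2k-1}$ is exponentially distributed with mean $\frac{1}{\lambda_1k}$ and $\tau_{2k}$ is exponentially distributed with mean $\frac{1}{\lambda_2k}$; - if $V(0)=-c_2$, then for all $k\geq 1$, $\tau_{2k-1}$ is exponentially distributed with mean $\frac{1}{\lambda_2k}$ and $\tau_{2k}$ is exponentially distributed with mean $\frac{1}{\lambda_1k}$. Set $N(t):=\sum_{n\geq 1}1_{\{\tau_1+\cdots+\tau_n\leq t\}}$ (the number of changes of direction up to time $t$), $$V(t):=\frac{c_1-c_2}{2}+\frac{c_1+c_2}{2}\left(1_{\{V(0)=c_1\}}-1_{\{V(0)=-c_2\}}\right)(-1)^{N(t)},$$ so that the velocity $V(t)$ alternates between $c_1$ and $-c_2$, starting from $V(0)$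 and switching at the times $\tau_1,\ \tau_1+\tau_2,\ \ldots$, and $$D(t):=\int_0^tV(s)\,ds\qquad(t\geq 0).$$ *)

theory Defs
  imports "HOL-Probability.Probability"
begin

text \<open>Under the probability measure \<open>P\<close>, the random variables \<open>\<tau> 1, \<tau> 2, \<dots>\<close> are independent,
  and \<open>\<tau> (2 * k - 1)\<close>, \<open>\<tau> (2 * k)\<close> are exponentially distributed with means \<open>1 / (l * k)\<close> and
  \<open>1 / (m * k)\<close>. The parameter of \<^const>\<open>exponential_density\<close> is the rate, i.e. the inverse of
  the mean.\<close>

definition alternating_exponentials ::
    "'a measure \<Rightarrow> real \<Rightarrow> real \<Rightarrow> (nat \<Rightarrow> 'a \<Rightarrow> real) \<Rightarrow> bool" where
  "alternating_exponentials P l m \<tau> \<longleftrightarrow>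
     prob_space.indep_vars P (\<lambda>_. borel) \<tau> {1..} \<and>
     (\<forall>k\<ge>1. distributed P lborel (\<tau> (2 * k - 1)) (exponential_density (l * real k)) \<and>
            distributed P lborel (\<tau> (2 * k)) (exponential_density (m * real k)))"

text \<open>As \<open>V0\<close> takes the two values \<open>c1\<close> and \<open>- c2\<close> only, the conditional law given \<open>V0 = v\<close> is the
  elementary one: \<^term>\<open>uniform_measure M A\<close> is the measure \<open>B \<mapsto> P (A \<inter> B) / P A\<close>.
  Nothing is required about conditioning on a value that has probability zero
  (\<open>\<alpha> = 0\<close> or \<open>\<alpha> = 1\<close>). The entry \<open>\<tau> 0\<close> is never used.\<close>

locale damped_telegraph = prob_space M
  for M :: "'a measure" +
  fixes l1 l2 c1 c2 \<alpha> :: real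
    and V0 :: "'a \<Rightarrow> real"
    and \<tau> :: "nat \<Rightarrow> 'a \<Rightarrow> real"
  assumes l1_pos: "l1 > 0" and l2_pos: "l2 > 0"
    and c1_pos: "c1 > 0" and c2_pos: "c2 > 0"
    and \<alpha>_range: "\<alpha> \<in> {0..1}"
    and V0_rv: "random_variable borel V0"
    and prob_V0_c1: "prob {\<omega> \<in> space M. V0 \<omega> = c1} = \<alpha>"
    and prob_V0_c2: "prob {\<omega> \<in> space M. V0 \<omega> = - c2} = 1 - \<alpha>"
    and \<tau>_rv: "\<And>n. n \<ge> 1 \<Longrightarrow> random_variable borel (\<tau> n)"
    and given_c1: "prob {\<omega> \<in> space M. V0 \<omega> = c1} > 0 \<Longrightarrow>
      alternating_exponentials (uniform_measure M {\<omega> \<in> space M. V0 \<omega> = c1}) l1 l2 \<tau>"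
    and given_c2: "prob {\<omega> \<in> space M. V0 \<omega> = - c2} > 0 \<Longrightarrow>
      alternating_exponentials (uniform_measure M {\<omega> \<in> space M. V0 \<omega> = - c2}) l2 l1 \<tau>"

text \<open>Almost surely only finitely many indicators in the following sum are nonzero; on the remaining
  null set the sum has the value \<open>0\<close> by convention of \<^const>\<open>infsum\<close>.\<close>

definition telegraph_N :: "(nat \<Rightarrow> 'a \<Rightarrow> real) \<Rightarrow> real \<Rightarrow> 'a \<Rightarrow> nat" where
  "telegraph_N \<tau> t \<omega> = (\<Sum>\<^sub>\<infinity>n\<in>{1..}. of_bool ((\<Sum>i = 1..n. \<tau> i \<omega>) \<le> t))"

definition telegraph_V ::
    "real \<Rightarrow> real \<Rightarrow> ('a \<Rightarrow> real) \<Rightarrow> (nat \<Rightarrow> 'a \<Rightarrow> real) \<Rightarrow> real \<Rightarrow> 'a \<Rightarrow> real" where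
  "telegraph_V c1 c2 V0 \<tau> t \<omega> =
     (c1 - c2) / 2 +
     (c1 + c2) / 2 * (of_bool (V0 \<omega> = c1) - of_bool (V0 \<omega> = - c2)) * (- 1) ^ telegraph_N \<tau> t \<omega>"

definition telegraph_D ::
    "real \<Rightarrow> real \<Rightarrow> ('a \<Rightarrow> real) \<Rightarrow> (nat \<Rightarrow> 'a \<Rightarrow> real) \<Rightarrow> real \<Rightarrow> 'a \<Rightarrow> real" where
  "telegraph_D c1 c2 V0 \<tau> t \<omega> = (LBINT s:{0..t}. telegraph_V c1 c2 V0 \<tau> s \<omega>)"

text \<open>Extended-real valued, since the supremum may be infinite on some paths.\<close>

definition telegraph_Q ::
    "real \<Rightarrow> real \<Rightarrow> ('a \<Rightarrow> real) \<Rightarrow> (nat \<Rightarrow> 'a \<Rightarrow> real) \<Rightarrow> 'a \<Rightarrow> ereal" where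
  "telegraph_Q c1 c2 V0 \<tau> \<omega> = (SUP t\<in>{0..}. ereal (telegraph_D c1 c2 V0 \<tau> t \<omega>))"

end

theory Submission
  imports Defs
begin

text \<open>The path \<open>D\<close> is piecewise linear, so its supremum is the supremum of \<open>0\<close> and the values
  \<open>X k\<close> at the switching times, which are partial sums of independent variables. For
  \<open>0 < \<theta> < l1 / c1\<close> the exponential moments of \<open>\<theta> * X k\<close> are finite products that stay bounded in
  \<open>k\<close>, because the drift condition \<open>l2 * c1 < l1 * c2\<close> makes all but finitely many pairs of
  consecutive factors at most \<open>1\<close>. Doob's maximal inequality then bounds \<open>P (Q > q)\<close> by
  \<open>C * exp (- \<theta> * q)\<close>. Conversely, the first upward stretch alone, whose duration is exponential
  with rate \<open>l1\<close>, exceeds \<open>q\<close> with probability at least \<open>K * exp (- l1 / c1 * q)\<close>.\<close>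

subsection \<open>A maximal inequality for sums of independent variables\<close>

lemma (in prob_space) indep_var_nn_integral_mult:
  fixes X Y :: "'a \<Rightarrow> ennreal"
  assumes "indep_var borel X borel Y"
  shows "(\<integral>\<^sup>+\<omega>. X \<omega> * Y \<omega> \<partial>M) = (\<integral>\<^sup>+\<omega>. X \<omega> \<partial>M) * (\<integral>\<^sup>+\<omega>. Y \<omega> \<partial>M)"
proof -
  have "case_bool borel borel = (\<lambda>_. borel :: ennreal measure)"
    by (auto simp: fun_eq_iff split: bool.split)
  then have "indep_vars (\<lambda>_. borel) (case_bool X Y) UNIV"
    using assms by (simp add: indep_var_def)
  from indep_vars_nn_integral[OF _ this] show ?thesis
    by (simp add: UNIV_bool mult.commute)
qed

text \<open>Doob's maximal inequality for the martingale \<open>exp (Y 1 + \<dots> + Y k) / (m 1 * \<dots> * m k)\<close>; the bound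
  \<open>C\<close> on the normalising products turns a level for the partial sums into one for the martingale.\<close>

lemma (in prob_space) indep_sums_maximal_ineq:
  fixes Y :: "nat \<Rightarrow> 'a \<Rightarrow> real" and m :: "nat \<Rightarrow> real"
  assumes ind: "indep_vars (\<lambda>_. borel) Y {1..}"
    and m: "\<And>i. i \<ge> 1 \<Longrightarrow> (\<integral>\<^sup>+\<omega>. ennreal (exp (Y i \<omega>)) \<partial>M) = ennreal (m i)"
    and m_pos: "\<And>i. i \<ge> 1 \<Longrightarrow> m i > 0"
    and C: "\<And>k. (\<Prod>i=1..k. m i) \<le> C"
  shows "prob {\<omega> \<in> space M. \<exists>k\<ge>1. q < (\<Sum>i=1..k. Y i \<omega>)} \<le> C * exp (- q)"
proof -
  define S where "S k \<omega> = (\<Sum>i=1..k. Y i \<omega>)" for k \<omega>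
  define P where "P n = {\<omega> \<in> space M. \<exists>k\<in>{1..n}. q < S k \<omega>}" for n
  have C_pos: "C > 0"
    using C[of 0] by simp
  have Y[measurable]: "Y i \<in> borel_measurable M" if "i \<in> {1..}" for i
    using ind that unfolding indep_vars_def by auto
  have S[measurable]: "S k \<in> borel_measurable M" for k
    unfolding S_def by (intro borel_measurable_sum Y) auto
  have P[measurable]: "P n \<in> sets M" for n
    unfolding P_def by measurable
  have prod_pos: "(\<Prod>i=1..n. m i) > 0" for n
    by (intro prod_pos) (auto intro: m_pos)
  define u where "u n = (\<integral>\<^sup>+\<omega>. ennreal (exp (S n \<omega>)) * indicator (space M - P n) \<omega> \<partial>M)" for n
  have step: "(\<integral>\<^sup>+\<omega>. ennreal (exp (S (Suc n) \<omega>)) * indicator (space M - P n) \<omega> \<partial>M)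
      = u n * ennreal (m (Suc n))" for n
  proof -
    \<comment> \<open>\<open>F\<close> reads only the first \<open>n\<close> coordinates and
      \<open>G\<close> only the next one. Disjoint index sets make the past, including the event of
      no crossing, independent of the new increment.\<close>
    define F :: "(nat \<Rightarrow> real) \<Rightarrow> ennreal" where
      "F y = ennreal (exp (\<Sum>i=1..n. y i)) * (if \<exists>k\<in>{1..n}. q < (\<Sum>i=1..k. y i) then 0 else 1)" for y
    define G :: "(nat \<Rightarrow> real) \<Rightarrow> ennreal" where "G y = ennreal (exp (y (Suc n)))" for y
    have sum_meas[measurable]: "(\<lambda>y. \<Sum>i=1..k. y i) \<in> borel_measurable (PiM {1..n} (\<lambda>_. borel :: real measure))"
      if "k \<in> {1..n}" for k
      using that by (intro borel_measurable_sum measurable_component_singleton) auto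
    have "(\<lambda>y. \<Sum>i=1..n. y i) \<in> borel_measurable (PiM {1..n} (\<lambda>_. borel :: real measure))"
      by (intro borel_measurable_sum measurable_component_singleton) auto
    note [measurable] = this
    have F[measurable]: "F \<in> borel_measurable (PiM {1..n} (\<lambda>_. borel))"
      unfolding F_def by measurable
    have G: "G \<in> borel_measurable (PiM {Suc n} (\<lambda>_. borel))"
      unfolding G_def by measurable
    have "indep_var (PiM {1..n} (\<lambda>_. borel)) (\<lambda>\<omega>. restrict (\<lambda>i. Y i \<omega>) {1..n})
                    (PiM {Suc n} (\<lambda>_. borel)) (\<lambda>\<omega>. restrict (\<lambda>i. Y i \<omega>) {Suc n})"
      by (rule indep_var_restrict[OF ind]) auto
    from indep_var_compose[OF this F G]
    have "indep_var borel (\<lambda>\<omega>. F (restrict (\<lambda>i. Y i \<omega>) {1..n})) borel (\<lambda>\<omega>. G (restrict (\<lambda>i. Y i \<omega>) {Suc n}))"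
      by (simp add: comp_def)
    from indep_var_nn_integral_mult[OF this]
    have eq: "(\<integral>\<^sup>+\<omega>. F (restrict (\<lambda>i. Y i \<omega>) {1..n}) * G (restrict (\<lambda>i. Y i \<omega>) {Suc n}) \<partial>M)
      = (\<integral>\<^sup>+\<omega>. F (restrict (\<lambda>i. Y i \<omega>) {1..n}) \<partial>M) * ennreal (m (Suc n))"
      using m[of "Suc n"] by (simp add: G_def)
    have Feq: "F (restrict (\<lambda>i. Y i \<omega>) {1..n}) = ennreal (exp (S n \<omega>)) * indicator (space M - P n) \<omega>"
      if "\<omega> \<in> space M" for \<omega>
    proof -
      have "(\<Sum>i=1..k. restrict (\<lambda>i. Y i \<omega>) {1..n} i) = S k \<omega>" if "k \<le> n" for k
        using that unfolding S_def by (intro sum.cong) auto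
      then show ?thesis
        using that by (auto simp: F_def P_def indicator_def)
    qed
    have "u n = (\<integral>\<^sup>+\<omega>. F (restrict (\<lambda>i. Y i \<omega>) {1..n}) \<partial>M)"
      unfolding u_def by (intro nn_integral_cong) (simp add: Feq del: One_nat_def)
    moreover have "(\<integral>\<^sup>+\<omega>. ennreal (exp (S (Suc n) \<omega>)) * indicator (space M - P n) \<omega> \<partial>M)
        = (\<integral>\<^sup>+\<omega>. F (restrict (\<lambda>i. Y i \<omega>) {1..n}) * G (restrict (\<lambda>i. Y i \<omega>) {Suc n}) \<partial>M)"
      by (intro nn_integral_cong)
        (simp add: Feq G_def S_def exp_add ennreal_mult mult_ac del: One_nat_def)
    ultimately show ?thesis
      using eq by simp
  qed
  \<comment> \<open>\<open>u n\<close> is the part of the martingale's mass that has not crossed the level by time \<open>n\<close>.\<close>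
  have inv: "emeasure M (P n) * ennreal (exp q / C) + u n * ennreal (1 / (\<Prod>i=1..n. m i)) \<le> 1" for n
  proof (induction n)
    case 0
    have "u 0 = 1"
      using emeasure_space_1 by (simp add: u_def S_def P_def)
    moreover have "P 0 = {}"
      by (simp add: P_def)
    ultimately show ?case
      by simp
  next
    case (Suc n)
    define E where "E = {\<omega> \<in> space M. q < S (Suc n) \<omega>} - P n"
    have E[measurable]: "E \<in> sets M"
      unfolding E_def by measurable
    have PS: "P (Suc n) = P n \<union> E" "P n \<inter> E = {}"
      by (auto simp: P_def E_def atLeastAtMostSuc_conv)
    have emP: "emeasure M (P (Suc n)) = emeasure M (P n) + emeasure M E"
      using PS by (simp add: plus_emeasure)
    \<comment> \<open>The complement of \<open>P n\<close> splits into the complement of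
      \<open>P (Suc n)\<close> and the fresh crossings \<open>E\<close>, on which the exponential
      exceeds \<open>exp q\<close>.\<close>
    have "u (Suc n) + ennreal (exp q) * emeasure M E
      = (\<integral>\<^sup>+\<omega>. ennreal (exp (S (Suc n) \<omega>)) * indicator (space M - P (Suc n)) \<omega>
           + ennreal (exp q) * indicator E \<omega> \<partial>M)"
      unfolding u_def by (simp add: nn_integral_add nn_integral_cmult_indicator)
    also have "\<dots> \<le> (\<integral>\<^sup>+\<omega>. ennreal (exp (S (Suc n) \<omega>)) * indicator (space M - P n) \<omega> \<partial>M)"
      using PS by (intro nn_integral_mono) (auto simp: indicator_def E_def intro!: ennreal_leI)
    also have "\<dots> = u n * ennreal (m (Suc n))"
      by (rule step)
    finally have le: "u (Suc n) + ennreal (exp q) * emeasure M E \<le> u n * ennreal (m (Suc n))" .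
    \<comment> \<open>\<open>p\<close> normalises the martingale at time \<open>Suc n\<close>. Its
      reciprocal is at most \<open>C\<close>, so a crossing contributes at least
      \<open>exp q / C\<close> whenever it happens.\<close>
    define p where "p = 1 / (\<Prod>i=1..Suc n. m i)"
    have p: "p > 0" "m (Suc n) * p = 1 / (\<Prod>i=1..n. m i)" "exp q / C \<le> exp q * p"
      using prod_pos[of "Suc n"] C[of "Suc n"] C_pos m_pos[of "Suc n"]
      by (auto simp: p_def field_simps)
    have "ennreal (exp q / C) \<le> ennreal (exp q) * ennreal p"
      using p by (simp add: ennreal_mult[symmetric] ennreal_leI)
    then have "emeasure M E * ennreal (exp q / C) \<le> emeasure M E * (ennreal (exp q) * ennreal p)"
      by (rule mult_left_mono) simp
    then have "emeasure M E * ennreal (exp q / C) + u (Suc n) * ennreal p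
        \<le> emeasure M E * (ennreal (exp q) * ennreal p) + u (Suc n) * ennreal p"
      by (rule add_right_mono)
    also have "\<dots> = (u (Suc n) + ennreal (exp q) * emeasure M E) * ennreal p"
      by (subst distrib_right) (simp only: add.commute mult_ac)
    also have "\<dots> \<le> u n * ennreal (m (Suc n)) * ennreal p"
      using le by (rule mult_right_mono) simp
    also have "\<dots> = u n * ennreal (1 / (\<Prod>i=1..n. m i))"
      using p(1) m_pos[of "Suc n"] by (simp add: mult.assoc ennreal_mult[symmetric] p(2)[symmetric] del: One_nat_def)
    finally have "emeasure M (P n) * ennreal (exp q / C) +
        (emeasure M E * ennreal (exp q / C) + u (Suc n) * ennreal p) \<le> 1"
      using Suc by (meson add_left_mono order_trans)
    then show ?case
      by (simp only: emP distrib_right add.assoc flip: p_def)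
  qed
  have "prob (P n) \<le> C * exp (- q)" for n
  proof -
    have "emeasure M (P n) * ennreal (exp q / C) \<le> 1"
      using inv[of n] by (meson add_increasing2 le_iff_add order_trans)
    then have "prob (P n) * (exp q / C) \<le> 1"
      using C_pos by (simp add: emeasure_eq_measure ennreal_mult[symmetric] flip: ennreal_1)
    then show ?thesis
      using C_pos by (simp add: exp_minus field_simps)
  qed
  \<comment> \<open>The bound is uniform in \<open>n\<close>; continuity from below removes the
    finite horizon.\<close>
  moreover have "(\<lambda>n. prob (P n)) \<longlonglongrightarrow> prob (\<Union>n. P n)"
    by (rule finite_Lim_measure_incseq) (auto simp: incseq_def P_def intro: order_trans)
  moreover have "(\<Union>n. P n) = {\<omega> \<in> space M. \<exists>k\<ge>1. q < S k \<omega>}"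
    by (auto simp: P_def) (meson atLeastAtMost_iff order_refl)
  ultimately show ?thesis
    by (auto simp: S_def intro: LIMSEQ_le_const2)
qed

text \<open>Exponential tilting: multiplying the density of rate \<open>r\<close> by
  \<open>exp (s * x)\<close> gives \<open>r / (r - s)\<close> times the density of rate
  \<open>r - s\<close>, which has total mass 1.\<close>

lemma (in prob_space) exponential_distributed_exp_moment:
  assumes D: "distributed M lborel X (exponential_density r)" and r: "0 < r" and s: "s < r"
  shows "(\<integral>\<^sup>+\<omega>. ennreal (exp (s * X \<omega>)) \<partial>M) = ennreal (r / (r - s))"
proof -
  interpret E: prob_space "density lborel (exponential_density (r - s))"
    using s by (intro prob_space_exponential_density) simp
  have eq: "ennreal (exponential_density r x) * ennreal (exp (s * x))
      = ennreal (r / (r - s)) * ennreal (exponential_density (r - s) x)" for x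
  proof -
    have "exponential_density r x * exp (s * x) = r / (r - s) * exponential_density (r - s) x"
    proof -
      have "exp (- x * (r - s)) = exp (- x * r) * exp (s * x)"
        by (simp add: exp_add[symmetric] algebra_simps)
      then show ?thesis
        using s by (simp add: exponential_density_def)
    qed
    then show ?thesis
      using r s by (simp add: ennreal_mult[symmetric] exponential_density_nonneg)
  qed
  have "(\<integral>\<^sup>+\<omega>. ennreal (exp (s * X \<omega>)) \<partial>M)
      = (\<integral>\<^sup>+x. ennreal (exponential_density r x) * ennreal (exp (s * x)) \<partial>lborel)"
    by (rule distributed_nn_integral[OF D, symmetric]) simp
  also have "\<dots> = ennreal (r / (r - s)) * (\<integral>\<^sup>+x. ennreal (exponential_density (r - s) x) \<partial>lborel)"
    by (simp add: eq nn_integral_cmult)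
  also have "(\<integral>\<^sup>+x. ennreal (exponential_density (r - s) x) \<partial>lborel) = 1"
    using E.emeasure_space_1 by (simp add: emeasure_density)
  finally show ?thesis
    by simp
qed

subsection \<open>Alternating exponential variables\<close>

text \<open>One pattern serves for rates, velocities and moment parameters. Stretches are numbered
  from 1, so the first argument belongs to the initial direction.\<close>

definition alternate :: "real \<Rightarrow> real \<Rightarrow> nat \<Rightarrow> real" where
  "alternate d e i = (if odd i then d else e)"

text \<open>\<open>Suc i div 2\<close> is the number \<open>k\<close> of the pair that contains
  \<open>i = 2 * k - 1\<close> or \<open>i = 2 * k\<close>, which merges the two families of rates
  into one formula.\<close>

lemma alternating_exponentials_distributed:
  assumes "alternating_exponentials P l m \<tau>" "i \<ge> 1"
  shows "distributed P lborel (\<tau> i) (exponential_density (alternate l m i * real (Suc i div 2)))"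
proof (cases "odd i")
  case True
  then obtain k where k: "i = 2 * k + 1"
    by (auto elim: oddE)
  with assms(1) show ?thesis
    unfolding alternating_exponentials_def alternate_def
    by (auto dest!: spec[of _ "Suc k"])
next
  case False
  then obtain k where k: "i = 2 * k"
    by (auto elim: evenE)
  with assms show ?thesis
    unfolding alternating_exponentials_def alternate_def
    by (auto dest!: conjunct2 spec[of _ k])
qed

text \<open>A pair of consecutive factors is \<open>1 / (1 - (a + b) / j + a * b / j\<^sup>2)\<close>, which is at most \<open>1\<close> for
  large \<open>j\<close> because \<open>a + b < 0\<close>.\<close>

lemma alternate_prod_bounded:
  fixes a b :: real
  assumes a: "a < 1" and b: "b < 1" and ab: "a + b < 0"
  shows "\<exists>C. \<forall>k. (\<Prod>i=1..k. 1 / (1 - alternate a b i / real (Suc i div 2))) \<le> C"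
proof -
  define p where "p k = (\<Prod>i=1..k. 1 / (1 - alternate a b i / real (Suc i div 2)))" for k
  \<comment> \<open>The factors with indices \<open>2 * j + 1\<close> and \<open>2 * j + 2\<close>
    share the divisor \<open>Suc j\<close>; \<open>g j\<close> is their product.\<close>
  define g where "g j = 1 / ((1 - a / real (Suc j)) * (1 - b / real (Suc j)))" for j
  have lt: "c / real (Suc j) < 1" if "c < 1" for c j
    using that by (simp add: divide_simps)
  have g_pos: "g j > 0" for j
    using lt[OF a] lt[OF b] unfolding g_def by simp
  \<comment> \<open>From this index on, \<open>Suc j * - (a + b)\<close> dominates
    \<open>\<bar>a * b\<bar>\<close>, so the denominator of \<open>g j\<close> is at least
    1.\<close>
  define J where "J = nat \<lceil>\<bar>a * b\<bar> / - (a + b)\<rceil>"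
  have g_le: "g j \<le> 1" if "j \<ge> J" for j
  proof -
    have "\<bar>a * b\<bar> / - (a + b) \<le> real (Suc j)"
      using that unfolding J_def by linarith
    then have "\<bar>a * b\<bar> \<le> real (Suc j) * - (a + b)"
      using ab by (subst (asm) pos_divide_le_eq) auto
    then have "real (Suc j) * (a + b) \<le> a * b"
      by (simp only: mult_minus_right)
    then have "0 \<le> (a * b - real (Suc j) * (a + b)) / (real (Suc j))^2"
      by (intro divide_nonneg_pos) auto
    also have "\<dots> = (1 - a / real (Suc j)) * (1 - b / real (Suc j)) - 1"
    proof -
      have "(a * b - x * (a + b)) / x\<^sup>2 = (1 - a / x) * (1 - b / x) - 1" if "x \<noteq> 0" for x
        using that by (simp add: field_simps power2_eq_square)
      then show ?thesis
        by simp
    qed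
    finally show ?thesis
      unfolding g_def by simp
  qed
  have even: "p (2 * n) = (\<Prod>j<n. g j)" for n
    by (induction n) (auto simp: p_def g_def alternate_def)
  \<comment> \<open>Raising every factor to at least 1 makes the products monotone, and they are
    constant from \<open>J\<close> on.\<close>
  define K where "K = (\<Prod>j<J. max 1 (g j))"
  have K: "(\<Prod>j<n. max 1 (g j)) \<le> K" for n
  proof (cases "n \<le> J")
    case True
    then show ?thesis
      unfolding K_def by (intro prod_mono2) auto
  next
    case False
    have "(\<Prod>j<n. max 1 (g j)) = (\<Prod>j<J. max 1 (g j))"
      using False g_le by (intro prod.mono_neutral_right) (auto simp: max_def intro: antisym)
    then show ?thesis
      by (simp add: K_def)
  qed
  have "(\<Prod>j<n. g j) \<le> (\<Prod>j<n. max 1 (g j))" for n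
    using g_pos by (intro prod_mono) (auto simp: less_imp_le)
  with K have even_le: "p (2 * n) \<le> K" for n
    unfolding even using order_trans by blast
  have K_pos: "K \<ge> 1"
    unfolding K_def by (intro prod_ge_1) auto
  \<comment> \<open>A product of odd length has one unpaired factor
    \<open>1 / (1 - a / Suc n)\<close>. It is at most 1 for \<open>a \<le> 0\<close>, and otherwise
    largest at \<open>n = 0\<close>.\<close>
  define R where "R = max 1 (1 / (1 - a))"
  have odd_le: "p (2 * n + 1) \<le> K * R" for n
  proof -
    have R: "1 / (1 - a / real (Suc n)) \<le> R"
    proof (cases "a \<le> 0")
      case True
      then have "1 / (1 - a / real (Suc n)) \<le> 1"
        by (simp add: divide_simps)
      then show ?thesis by (simp add: R_def)
    next
      case False
      then have "a / real (Suc n) \<le> a / 1"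
        by (intro divide_left_mono) auto
      then have "1 - a \<le> 1 - a / real (Suc n)"
        by simp
      then have "1 / (1 - a / real (Suc n)) \<le> 1 / (1 - a)"
        using a by (intro divide_left_mono mult_pos_pos) (use lt[OF a, of n] in auto)
      then show ?thesis by (simp add: R_def)
    qed
    have "p (2 * n + 1) = p (2 * n) * (1 / (1 - a / real (Suc n)))"
      by (simp add: p_def alternate_def)
    also have "\<dots> \<le> K * R"
      using R even_le K_pos lt[OF a, of n] by (intro mult_mono) auto
    finally show ?thesis .
  qed
  have "p k \<le> K * R" for k
  proof (cases "odd k")
    case True
    then show ?thesis
      using odd_le by (auto elim!: oddE)
  next
    case False
    then obtain n where "k = 2 * n"
      by (auto elim: evenE)
    moreover have "K * 1 \<le> K * R"
      using K_pos by (intro mult_left_mono) (auto simp: R_def)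
    ultimately show ?thesis
      using even_le[of n] by simp
  qed
  then show ?thesis
    unfolding p_def by blast
qed

text \<open>With \<open>a = \<theta> * d / l\<close> and \<open>b = \<theta> * e / m\<close>, the
  exponential moments of the scaled increments are the factors of the bounded product. The bounds on
  \<open>\<theta>\<close> give \<open>a < 1\<close> and \<open>b < 1\<close>, and the drift times
  \<open>\<theta>\<close> gives \<open>a + b < 0\<close>.\<close>

lemma alternating_exponentials_maximal:
  assumes "prob_space P" and alt: "alternating_exponentials P l m \<tau>"
    and l: "l > 0" and m: "m > 0" and drift: "d / l + e / m < 0"
    and \<theta>: "\<theta> > 0" "\<theta> * d < l" "\<theta> * e < m"
  shows "\<exists>C. \<forall>q. measure P {\<omega> \<in> space P. \<exists>k\<ge>1. q < (\<Sum>i=1..k. alternate d e i * \<tau> i \<omega>)}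
           \<le> C * exp (- (\<theta> * q))"
proof -
  interpret prob_space P by fact
  define f where "f i = 1 / (1 - alternate (\<theta> * d / l) (\<theta> * e / m) i / real (Suc i div 2))" for i
  have "\<theta> * d / l + \<theta> * e / m = \<theta> * (d / l + e / m)"
    by (simp add: distrib_left)
  also have "\<dots> < 0"
    using \<theta>(1) drift by (rule mult_pos_neg)
  finally obtain C where C: "\<And>k. (\<Prod>i=1..k. f i) \<le> C"
    using alternate_prod_bounded[of "\<theta> * d / l" "\<theta> * e / m"] \<theta> l m by (auto simp: f_def)
  have moment: "f i > 0 \<and> (\<integral>\<^sup>+\<omega>. ennreal (exp (\<theta> * (alternate d e i * \<tau> i \<omega>))) \<partial>P) = ennreal (f i)"
    if i: "i \<ge> 1" for i
  proof -
    define r where "r = alternate l m i * real (Suc i div 2)"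
    define s where "s = \<theta> * alternate d e i"
    have n: "real (Suc i div 2) \<ge> 1"
      using i by (simp add: Suc_le_eq div_greater_zero_iff)
    have L: "alternate l m i > 0"
      using l m by (simp add: alternate_def)
    \<comment> \<open>The rate is smallest in the first pair, so finiteness of the moments there
      gives it for every index.\<close>
    have "s < alternate l m i * 1"
      using \<theta> by (simp add: alternate_def s_def)
    also have "\<dots> \<le> r"
      unfolding r_def using n L by (intro mult_left_mono) auto
    finally have s: "s < r" .
    have r: "r > 0"
      using n L by (simp add: r_def)
    have "f i = 1 / (1 - s / r)"
      by (simp add: f_def r_def s_def alternate_def)
    also have "\<dots> = r / (r - s)"
      using r s by (simp add: field_simps)
    finally have "f i = r / (r - s)" .
    then show ?thesis
      using exponential_distributed_exp_moment[OF alternating_exponentials_distributed[OF alt i, folded r_def] r s] r s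
      by (simp add: s_def mult.assoc)
  qed
  have "indep_vars (\<lambda>_. borel) (\<lambda>i \<omega>. \<theta> * (alternate d e i * \<tau> i \<omega>)) {1..}"
    using alt unfolding alternating_exponentials_def
    by (intro indep_vars_compose2[where Y = "\<lambda>i x. \<theta> * (alternate d e i * x)" and M' = "\<lambda>_. borel"]) auto
  then have "prob {\<omega> \<in> space P. \<exists>k\<ge>1. \<theta> * q < (\<Sum>i=1..k. \<theta> * (alternate d e i * \<tau> i \<omega>))}
      \<le> C * exp (- (\<theta> * q))" for q
    by (rule indep_sums_maximal_ineq[where m = f]) (use moment C in auto)
  then show ?thesis
    using \<theta>(1) by (intro exI[of _ C]) (simp add: sum_distrib_left[symmetric])
qed

text \<open>Switching times do not accumulate. The rates grow at most linearly, so by divergence of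
  the harmonic series the Laplace transform of the \<open>n\<close>-th partial sum at 1 is at most
  \<open>K / harm n\<close> and tends to 0; by Markov's inequality, staying below a level has
  probability 0.\<close>

lemma alternating_exponentials_sum_unbounded:
  assumes "prob_space P" and alt: "alternating_exponentials P l m \<tau>"
    and l: "l > 0" and m: "m > 0"
  shows "AE \<omega> in P. \<forall>T. \<exists>n. T < (\<Sum>i=1..n. \<tau> i \<omega>)"
proof -
  interpret prob_space P by fact
  define r where "r i = alternate l m i * real (Suc i div 2)" for i
  define K where "K = max l m"
  have K_pos: "K > 0"
    using l by (simp add: K_def)
  have r: "r i > 0 \<and> r i \<le> K * real i" if "i \<ge> 1" for i
  proof -
    have "r i \<le> K * real (Suc i div 2)"
      unfolding r_def K_def alternate_def by (intro mult_right_mono) auto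
    also have "\<dots> \<le> K * real i"
      using K_pos that by (intro mult_left_mono) auto
    finally have "r i \<le> K * real i" .
    moreover have "real (Suc i div 2) \<ge> 1"
      using that by (simp add: Suc_le_eq div_greater_zero_iff)
    ultimately show ?thesis
      using l m by (auto simp: r_def alternate_def)
  qed
  have \<tau>[measurable]: "\<tau> i \<in> borel_measurable P" if "i \<in> {1..}" for i
    using alt that unfolding alternating_exponentials_def indep_vars_def by auto
  have S[measurable]: "(\<lambda>\<omega>. \<Sum>i=1..n. \<tau> i \<omega>) \<in> borel_measurable P" for n
    by (intro borel_measurable_sum \<tau>) auto
  have moment: "(\<integral>\<^sup>+\<omega>. ennreal (exp (- \<tau> i \<omega>)) \<partial>P) = ennreal (r i / (r i + 1))" if "i \<ge> 1" for i
    using exponential_distributed_exp_moment[OF alternating_exponentials_distributed[OF alt that], of "-1"] r[OF that]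
    by (simp add: r_def)
  have bound: "prob {\<omega> \<in> space P. \<forall>n. (\<Sum>i=1..n. \<tau> i \<omega>) \<le> T} \<le> exp T * K / harm n" if "n \<ge> 1" for T n
  proof -
    have "indep_vars (\<lambda>_. borel) (\<lambda>i \<omega>. ennreal (exp (- \<tau> i \<omega>))) {1..n}"
      using alt unfolding alternating_exponentials_def
      by (intro indep_vars_compose2[where Y = "\<lambda>i x. ennreal (exp (- x))" and M' = "\<lambda>_. borel"])
        (auto intro: indep_vars_subset)
    from indep_vars_nn_integral[OF _ this]
    have "(\<integral>\<^sup>+\<omega>. (\<Prod>i=1..n. ennreal (exp (- \<tau> i \<omega>))) \<partial>P) = (\<Prod>i=1..n. ennreal (r i / (r i + 1)))"
      by (simp add: moment)
    also have "\<dots> = ennreal (\<Prod>i=1..n. r i / (r i + 1))"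
      by (intro prod_ennreal) (use r in \<open>auto simp: less_imp_le\<close>)
    finally have eq: "(\<integral>\<^sup>+\<omega>. ennreal (exp (- (\<Sum>i=1..n. \<tau> i \<omega>))) \<partial>P) = ennreal (\<Prod>i=1..n. r i / (r i + 1))"
      by (simp add: prod_ennreal exp_sum sum_negf[symmetric])
    have "harm n / K = (\<Sum>i=1..n. 1 / (K * real i))"
      by (simp add: harm_def divide_inverse sum_distrib_left mult.commute)
    also have "\<dots> \<le> (\<Sum>i=1..n. 1 / r i)"
      using r K_pos by (intro sum_mono divide_left_mono) auto
    \<comment> \<open>The product is the reciprocal of the Laplace transform; expanding it leaves at
      least the sum of the \<open>1 / r i\<close>.\<close>
    also have "\<dots> \<le> (\<Prod>i=1..n. 1 + 1 / r i)"
      using sum_le_prod[of "{1..n}" "\<lambda>i. 1 / r i"] r by (auto simp: less_imp_le)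
    also have "\<dots> = 1 / (\<Prod>i=1..n. r i / (r i + 1))"
    proof -
      have "(\<Prod>i=1..n. 1 + 1 / r i) = (\<Prod>i=1..n. 1 / (r i / (r i + 1)))"
      proof (intro prod.cong refl)
        fix i assume "i \<in> {1..n}"
        then have "r i > 0"
          using r by simp
        then show "1 + 1 / r i = 1 / (r i / (r i + 1))"
          by (simp add: field_simps)
      qed
      then show ?thesis
        by (simp add: prod_dividef)
    qed
    finally have harm: "harm n / K \<le> 1 / (\<Prod>i=1..n. r i / (r i + 1))" .
    have "(harm n :: real) > 0"
      using that by (intro harm_pos) simp
    moreover have "(\<Prod>i=1..n. r i / (r i + 1)) > 0"
      using r by (intro prod_pos) (auto intro!: divide_pos_pos add_pos_pos)
    ultimately have le: "(\<Prod>i=1..n. r i / (r i + 1)) \<le> K / harm n"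
      using harm K_pos by (simp add: field_simps)
    \<comment> \<open>Markov's inequality: on this event the \<open>n\<close>-th partial sum is at
      most \<open>T\<close>, so the integrand on the right is at least 1.\<close>
    have "emeasure P {\<omega> \<in> space P. \<forall>n. (\<Sum>i=1..n. \<tau> i \<omega>) \<le> T}
        = (\<integral>\<^sup>+\<omega>. indicator {\<omega> \<in> space P. \<forall>n. (\<Sum>i=1..n. \<tau> i \<omega>) \<le> T} \<omega> \<partial>P)"
      by simp
    also have "\<dots> \<le> (\<integral>\<^sup>+\<omega>. ennreal (exp T) * ennreal (exp (- (\<Sum>i=1..n. \<tau> i \<omega>))) \<partial>P)"
      by (intro nn_integral_mono)
        (auto simp: indicator_def ennreal_mult[symmetric] exp_add[symmetric] simp flip: ennreal_1 intro!: ennreal_leI)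
    also have "\<dots> = ennreal (exp T) * ennreal (\<Prod>i=1..n. r i / (r i + 1))"
      by (simp add: nn_integral_cmult eq del: One_nat_def)
    also have "\<dots> \<le> ennreal (exp T) * ennreal (K / harm n)"
      using le by (intro mult_left_mono ennreal_leI) auto
    also have "\<dots> = ennreal (exp T * K / harm n)"
      using K_pos by (simp add: ennreal_mult[symmetric] harm_nonneg)
    finally show ?thesis
      using K_pos \<open>harm n > 0\<close> by (simp add: emeasure_eq_measure)
  qed
  have "prob {\<omega> \<in> space P. \<forall>n. (\<Sum>i=1..n. \<tau> i \<omega>) \<le> T} = 0" for T
  proof -
    have "(\<lambda>n. exp T * K / harm n) \<longlonglongrightarrow> 0"
      by (intro tendsto_divide_0[OF tendsto_const] filterlim_at_top_imp_at_infinity harm_at_top)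
    then have "prob {\<omega> \<in> space P. \<forall>n. (\<Sum>i=1..n. \<tau> i \<omega>) \<le> T} \<le> 0"
      by (rule LIMSEQ_le_const) (use bound in blast)
    then show ?thesis
      by (simp add: measure_le_0_iff)
  qed
  then have "AE \<omega> in P. \<exists>n. T < (\<Sum>i=1..n. \<tau> i \<omega>)" for T
    by (subst AE_iff_measurable[OF _ refl]) (auto simp: emeasure_eq_measure not_less)
  \<comment> \<open>Integer levels suffice, and countably many null sets may be united.\<close>
  then have "AE \<omega> in P. \<forall>k::nat. \<exists>n. real k < (\<Sum>i=1..n. \<tau> i \<omega>)"
    by (subst AE_all_countable) simp
  then show ?thesis
  proof eventually_elim
    case (elim \<omega>)
    then show ?case
      by (meson le_less_trans reals_Archimedean2 less_imp_le)
  qed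
qed

subsection \<open>Measurability and the shape of the paths\<close>

text \<open>Measurability of \<^const>\<open>telegraph_N\<close> is needed on all of the sample space, including the paths on
  which \<^const>\<open>infsum\<close> has its default value: otherwise the measure of \<open>{Q > q}\<close> could be the junk
  value \<open>0\<close>.\<close>

lemma telegraph_N_eq_suminf:
  "real (telegraph_N \<tau> t \<omega>) = (if \<exists>m. \<forall>k>m. t < (\<Sum>i=1..k. \<tau> i \<omega>)
     then (\<Sum>n. of_bool ((\<Sum>i=1..Suc n. \<tau> i \<omega>) \<le> t)) else 0)"
proof -
  define S where "S k = (\<Sum>i=1..k. \<tau> i \<omega>)" for k
  define f :: "nat \<Rightarrow> nat" where "f n = of_bool (S n \<le> t)" for n
  have N: "telegraph_N \<tau> t \<omega> = infsum f {1..}"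
    unfolding telegraph_N_def f_def S_def ..
  show ?thesis
  proof (cases "\<exists>m. \<forall>k>m. t < S k")
    case True
    then obtain m where m: "\<And>k. k > m \<Longrightarrow> t < S k"
      by blast
    have "infsum f {1..} = infsum f {1..m}"
      using m by (intro infsum_cong_neutral) (auto simp: f_def not_le)
    moreover have "(\<Sum>n. of_bool (S (Suc n) \<le> t) :: real) = (\<Sum>n\<in>{..<m}. of_bool (S (Suc n) \<le> t))"
      using m by (intro suminf_finite) (auto simp: not_le not_less)
    moreover have "\<dots> = real (\<Sum>n\<in>{1..m}. f n)"
      by (simp add: f_def sum.atLeast1_atMost_eq)
    ultimately show ?thesis
      using True by (simp add: N S_def)
  next
    case False
    have "infinite {n \<in> {1..}. f n \<noteq> 0}"
    proof
      assume "finite {n \<in> {1..}. f n \<noteq> 0}"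
      then obtain m where m: "\<And>n. n \<in> {n \<in> {1..}. f n \<noteq> 0} \<Longrightarrow> n \<le> m"
        by (meson finite_nat_set_iff_bounded_le)
      have "\<forall>k>m. t < S k"
      proof (intro allI impI, rule ccontr)
        fix k assume k: "m < k" "\<not> t < S k"
        then have "k \<in> {n \<in> {1..}. f n \<noteq> 0}"
          by (simp add: f_def)
        with m k show False
          by fastforce
      qed
      with False show False
        by blast
    qed
    \<comment> \<open>For natural-number summands, summability means finite support, so infinite
      support yields the default value of \<open>infsum\<close>.\<close>
    then have "infsum f {1..} = 0"
      by (intro infsum_not_exists) (simp add: summable_on_discrete_iff)
    then show ?thesis
      using False by (simp only: N S_def if_False of_nat_0)
  qed
qed

text \<open>Measurability is joint in path and time because \<open>telegraph_D\<close> integrates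
  over time and must remain measurable in the path.\<close>

lemma measurable_telegraph_N:
  assumes \<tau>: "\<And>n. n \<ge> 1 \<Longrightarrow> \<tau> n \<in> borel_measurable M"
  shows "(\<lambda>p. telegraph_N \<tau> (snd p) (fst p)) \<in> measurable (M \<Otimes>\<^sub>M borel) (count_space UNIV)"
proof -
  have [measurable]: "(\<lambda>\<omega>. \<Sum>i=1..k. \<tau> i \<omega>) \<in> borel_measurable M" for k
    using \<tau> by (intro borel_measurable_sum) auto
  \<comment> \<open>The right-hand side uses only countable quantifiers and a countable real sum;
    the floor and \<open>nat\<close> return to the natural numbers.\<close>
  have "telegraph_N \<tau> t \<omega> = nat \<lfloor>if \<exists>m. \<forall>k>m. t < (\<Sum>i=1..k. \<tau> i \<omega>)
     then (\<Sum>n. of_bool ((\<Sum>i=1..Suc n. \<tau> i \<omega>) \<le> t)) else 0 :: real\<rfloor>" for t \<omega>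
    by (simp only: telegraph_N_eq_suminf[symmetric]) simp
  then show ?thesis
    by (simp only:) measurable
qed

lemma measurable_telegraph_V:
  assumes \<tau>: "\<And>n. n \<ge> 1 \<Longrightarrow> \<tau> n \<in> borel_measurable M"
    and [measurable]: "V0 \<in> borel_measurable M"
  shows "(\<lambda>p. telegraph_V c1 c2 V0 \<tau> (snd p) (fst p)) \<in> borel_measurable (M \<Otimes>\<^sub>M borel)"
proof -
  have [measurable]: "(\<lambda>p. (- 1) ^ telegraph_N \<tau> (snd p) (fst p) :: real) \<in> borel_measurable (M \<Otimes>\<^sub>M borel)"
    by (rule measurable_compose[OF measurable_telegraph_N[OF \<tau>]]) auto
  show ?thesis
    unfolding telegraph_V_def by measurable
qed

lemma borel_measurable_telegraph_V_path:
  assumes "\<And>n. n \<ge> 1 \<Longrightarrow> \<tau> n \<in> borel_measurable M" "V0 \<in> borel_measurable M" "\<omega> \<in> space M"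
  shows "(\<lambda>t. telegraph_V c1 c2 V0 \<tau> t \<omega>) \<in> borel_measurable borel"
  using measurable_compose[OF measurable_Pair1'[OF assms(3)] measurable_telegraph_V[OF assms(1,2)]]
  by simp

section \<open>Measurability of the position and of the tail events of the supremum\<close>

lemma measurable_telegraph_D:
  assumes "\<And>n. n \<ge> 1 \<Longrightarrow> \<tau> n \<in> borel_measurable M" "V0 \<in> borel_measurable M"
  shows "telegraph_D c1 c2 V0 \<tau> t \<in> borel_measurable M"
proof -
  have [measurable]: "(\<lambda>p. telegraph_V c1 c2 V0 \<tau> (snd p) (fst p)) \<in> borel_measurable (M \<Otimes>\<^sub>M lborel)"
    using measurable_telegraph_V[OF assms] by (simp cong: measurable_cong_sets)
  have "(\<lambda>\<omega>. \<integral>s. indicator {0..t} s *\<^sub>R telegraph_V c1 c2 V0 \<tau> s \<omega> \<partial>lborel) \<in> borel_measurable M"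
  proof (rule lborel.borel_measurable_lebesgue_integral)
    have "(\<lambda>p. indicator {0..t} (snd p) *\<^sub>R telegraph_V c1 c2 V0 \<tau> (snd p) (fst p))
        \<in> borel_measurable (M \<Otimes>\<^sub>M lborel)"
      by measurable
    then show "(\<lambda>(\<omega>, s). indicator {0..t} s *\<^sub>R telegraph_V c1 c2 V0 \<tau> s \<omega>)
        \<in> borel_measurable (M \<Otimes>\<^sub>M lborel)"
      by (simp add: case_prod_beta)
  qed
  moreover have "telegraph_D c1 c2 V0 \<tau> t
      = (\<lambda>\<omega>. \<integral>s. indicator {0..t} s *\<^sub>R telegraph_V c1 c2 V0 \<tau> s \<omega> \<partial>lborel)"
    by (simp add: fun_eq_iff telegraph_D_def set_lebesgue_integral_def)
  ultimately show ?thesis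
    by simp
qed

lemma set_integrable_telegraph_V:
  assumes "(\<lambda>t. telegraph_V c1 c2 V0 \<tau> t \<omega>) \<in> borel_measurable borel"
  shows "set_integrable lborel {a..b} (\<lambda>t. telegraph_V c1 c2 V0 \<tau> t \<omega>)"
  unfolding set_integrable_def
proof (rule integrableI_bounded_set_indicator)
  define B where "B = \<bar>(c1 - c2) / 2\<bar> + \<bar>(c1 + c2) / 2 * (of_bool (V0 \<omega> = c1) - of_bool (V0 \<omega> = - c2))\<bar>"
  have "\<bar>telegraph_V c1 c2 V0 \<tau> t \<omega>\<bar> \<le> B" for t
    unfolding telegraph_V_def B_def by (rule order_trans[OF abs_triangle_ineq]) (simp add: abs_mult power_abs)
  then show "AE t in lborel. t \<in> {a..b} \<longrightarrow> norm (telegraph_V c1 c2 V0 \<tau> t \<omega>) \<le> B"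
    by simp
qed (use assms in \<open>auto simp: emeasure_lborel_Icc_eq\<close>)

text \<open>The passage from the Lebesgue to the gauge integral gives access to continuity of the
  indefinite integral and to splitting over adjacent intervals.\<close>

lemma telegraph_D_eq_integral:
  assumes "(\<lambda>t. telegraph_V c1 c2 V0 \<tau> t \<omega>) \<in> borel_measurable borel"
  shows "(\<lambda>t. telegraph_V c1 c2 V0 \<tau> t \<omega>) integrable_on {0..t}"
    and "telegraph_D c1 c2 V0 \<tau> t \<omega> = integral {0..t} (\<lambda>t. telegraph_V c1 c2 V0 \<tau> t \<omega>)"
  using set_borel_integral_eq_integral[OF set_integrable_telegraph_V[OF assms]]
  by (auto simp: telegraph_D_def)

lemma less_telegraph_Q_iff: "ereal q < telegraph_Q c1 c2 V0 \<tau> \<omega> \<longleftrightarrow> (\<exists>t\<ge>0. q < telegraph_D c1 c2 V0 \<tau> t \<omega>)"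
  by (auto simp: telegraph_Q_def less_SUP_iff)

text \<open>By continuity of the path, a strict excess over \<open>q\<close> persists at nearby
  rational times; this turns the tail event into a countable union.\<close>

lemma less_telegraph_Q_iff_rational:
  assumes "(\<lambda>t. telegraph_V c1 c2 V0 \<tau> t \<omega>) \<in> borel_measurable borel"
  shows "ereal q < telegraph_Q c1 c2 V0 \<tau> \<omega>
    \<longleftrightarrow> (\<exists>r\<in>{r\<in>\<rat>. 0 \<le> r}. q < telegraph_D c1 c2 V0 \<tau> r \<omega>)"
proof
  assume "ereal q < telegraph_Q c1 c2 V0 \<tau> \<omega>"
  then obtain t where t: "t \<ge> 0" "q < telegraph_D c1 c2 V0 \<tau> t \<omega>"
    by (auto simp: less_telegraph_Q_iff)
  \<comment> \<open>The interval reaches beyond \<open>t\<close> so that a rational can be chosen to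
    the right of \<open>t\<close>, where it is nonnegative even if \<open>t = 0\<close>.\<close>
  have "continuous_on {0..t+1} (\<lambda>t. telegraph_D c1 c2 V0 \<tau> t \<omega>)"
    using indefinite_integral_continuous_1[OF telegraph_D_eq_integral(1)[OF assms]]
    by (simp add: telegraph_D_eq_integral(2)[OF assms])
  then obtain \<delta> where \<delta>: "\<delta> > 0" "\<And>s. s \<in> {0..t+1} \<Longrightarrow> dist s t < \<delta> \<Longrightarrow>
      dist (telegraph_D c1 c2 V0 \<tau> s \<omega>) (telegraph_D c1 c2 V0 \<tau> t \<omega>) < telegraph_D c1 c2 V0 \<tau> t \<omega> - q"
    using t unfolding continuous_on_iff
    by (metis (no_types, lifting) add_increasing2 atLeastAtMost_iff diff_gt_0_iff_gt le_add_same_cancel1 zero_le_one)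
  obtain r where r: "r \<in> \<rat>" "t < r" "r < min (t + \<delta>) (t + 1)"
    using Rats_dense_in_real[of t "min (t + \<delta>) (t + 1)"] \<delta>(1) by auto
  then have "dist (telegraph_D c1 c2 V0 \<tau> r \<omega>) (telegraph_D c1 c2 V0 \<tau> t \<omega>) < telegraph_D c1 c2 V0 \<tau> t \<omega> - q"
    using t by (intro \<delta>(2)) (auto simp: dist_real_def)
  then have "q < telegraph_D c1 c2 V0 \<tau> r \<omega>"
    by (auto simp: dist_real_def)
  then show "\<exists>r\<in>{r\<in>\<rat>. 0 \<le> r}. q < telegraph_D c1 c2 V0 \<tau> r \<omega>"
    using r t by (intro bexI[of _ r]) auto
qed (auto simp: less_telegraph_Q_iff)

lemma sets_telegraph_Q_gt:
  assumes "\<And>n. n \<ge> 1 \<Longrightarrow> \<tau> n \<in> borel_measurable M" "V0 \<in> borel_measurable M"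
  shows "{\<omega> \<in> space M. ereal q < telegraph_Q c1 c2 V0 \<tau> \<omega>} \<in> sets M"
proof -
  have "countable {r\<in>\<rat>. 0 \<le> (r::real)}"
    by (rule countable_subset[OF _ countable_rat]) auto
  then have "{\<omega> \<in> space M. \<exists>r\<in>{r\<in>\<rat>. 0 \<le> r}. q < telegraph_D c1 c2 V0 \<tau> r \<omega>} \<in> sets M"
    by (intro sets.sets_Collect_countable_Ex') (use measurable_telegraph_D[OF assms] in measurable)
  also have "{\<omega> \<in> space M. \<exists>r\<in>{r\<in>\<rat>. 0 \<le> r}. q < telegraph_D c1 c2 V0 \<tau> r \<omega>}
      = {\<omega> \<in> space M. ereal q < telegraph_Q c1 c2 V0 \<tau> \<omega>}"
    using less_telegraph_Q_iff_rational[OF borel_measurable_telegraph_V_path[OF assms]] by auto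
  finally show ?thesis .
qed

text \<open>These properties hold for almost every path under each conditional law. They reduce the
  shape of the path to a deterministic argument; \<open>unbounded\<close> ensures that every time
  lies in some stretch between two switches.\<close>

locale telegraph_path =
  fixes c1 c2 :: real and V0 :: "'a \<Rightarrow> real" and \<tau> :: "nat \<Rightarrow> 'a \<Rightarrow> real" and \<omega> :: 'a
  assumes c1_pos: "c1 > 0" and c2_pos: "c2 > 0"
    and V0: "V0 \<omega> = c1 \<or> V0 \<omega> = - c2"
    and \<tau>_nonneg: "i \<ge> 1 \<Longrightarrow> \<tau> i \<omega> \<ge> 0"
    and unbounded: "\<exists>n. T < (\<Sum>i=1..n. \<tau> i \<omega>)"
    and V_measurable: "(\<lambda>t. telegraph_V c1 c2 V0 \<tau> t \<omega>) \<in> borel_measurable borel"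
begin

definition S :: "nat \<Rightarrow> real" where
  "S n = (\<Sum>i=1..n. \<tau> i \<omega>)"

text \<open>The two velocities add up to \<open>c1 - c2\<close>, so
  \<open>c1 - c2 - V0 \<omega>\<close> is the velocity opposite to the initial one.\<close>

definition v :: "nat \<Rightarrow> real" where
  "v = alternate (V0 \<omega>) (c1 - c2 - V0 \<omega>)"

definition X :: "nat \<Rightarrow> real" where
  "X n = (\<Sum>i=1..n. v i * \<tau> i \<omega>)"

lemma S_0: "S 0 = 0" and S_Suc: "S (Suc n) = S n + \<tau> (Suc n) \<omega>"
  by (simp_all add: S_def)

lemma S_mono: "m \<le> n \<Longrightarrow> S m \<le> S n"
  by (rule lift_Suc_mono_le[of S]) (simp_all add: S_Suc \<tau>_nonneg)

lemma S_nonneg: "S n \<ge> 0"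
  using S_mono[of 0 n] by (simp add: S_0)

lemma telegraph_N_eq:
  assumes "S n \<le> t" "t < S (Suc n)"
  shows "telegraph_N \<tau> t \<omega> = n"
proof -
  have *: "S k \<le> t \<longleftrightarrow> k \<le> n" for k
    using assms S_mono[of k n] S_mono[of "Suc n" k] by (cases "k \<le> n") auto
  have "telegraph_N \<tau> t \<omega> = infsum (\<lambda>k. of_bool (k \<le> n) :: nat) {1..}"
    by (simp add: telegraph_N_def S_def[symmetric] * del: One_nat_def)
  also have "\<dots> = infsum (\<lambda>k. 1 :: nat) {1..n}"
    by (rule infsum_cong_neutral) auto
  finally show ?thesis
    by simp
qed

lemma telegraph_V_eq:
  assumes "S n \<le> t" "t < S (Suc n)"
  shows "telegraph_V c1 c2 V0 \<tau> t \<omega> = v (Suc n)"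
  using V0 c1_pos c2_pos unfolding telegraph_V_def telegraph_N_eq[OF assms]
  by (cases "even n") (auto simp: v_def alternate_def field_simps)

lemma telegraph_V_has_integral_piece:
  assumes "S n \<le> t" "t \<le> S (Suc n)"
  shows "((\<lambda>t. telegraph_V c1 c2 V0 \<tau> t \<omega>) has_integral v (Suc n) * (t - S n)) {S n..t}"
proof -
  have "((\<lambda>_. v (Suc n)) has_integral v (Suc n) * (t - S n)) {S n..t}"
    using has_integral_const_real[of "v (Suc n)" "S n" t] assms by (simp add: mult.commute)
  \<comment> \<open>At the right end the velocity may already have switched; a single point does not
    affect the integral.\<close>
  then show ?thesis
    by (rule has_integral_spike_finite[of "{t}", rotated 2]) (use assms telegraph_V_eq in auto)
qed

lemma telegraph_V_has_integral:
  "((\<lambda>t. telegraph_V c1 c2 V0 \<tau> t \<omega>) has_integral X n) {0..S n}"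
proof (induction n)
  case 0
  show ?case
    using has_integral_refl(1)[of _ "0::real"] by (simp add: S_0 X_def)
next
  case (Suc n)
  have "((\<lambda>t. telegraph_V c1 c2 V0 \<tau> t \<omega>) has_integral X n + v (Suc n) * (S (Suc n) - S n)) {0..S (Suc n)}"
    using Suc telegraph_V_has_integral_piece[of n "S (Suc n)"] S_nonneg S_mono[of n "Suc n"]
    by (intro has_integral_combine[of 0 "S n"]) auto
  then show ?case
    by (simp add: X_def S_Suc)
qed

lemma telegraph_D_eq:
  assumes "S n \<le> t" "t \<le> S (Suc n)"
  shows "telegraph_D c1 c2 V0 \<tau> t \<omega> = X n + v (Suc n) * (t - S n)"
proof -
  have "((\<lambda>t. telegraph_V c1 c2 V0 \<tau> t \<omega>) has_integral X n + v (Suc n) * (t - S n)) {0..t}"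
    using telegraph_V_has_integral telegraph_V_has_integral_piece[OF assms] S_nonneg assms
    by (intro has_integral_combine[of 0 "S n"]) auto
  then show ?thesis
    using telegraph_D_eq_integral(2)[OF V_measurable] by (simp add: integral_unique)
qed

lemma less_telegraph_Q_if_less_X:
  assumes "q < X n"
  shows "ereal q < telegraph_Q c1 c2 V0 \<tau> \<omega>"
  unfolding less_telegraph_Q_iff
  using assms telegraph_D_eq[of n "S n"] S_nonneg[of n] S_mono[of n "Suc n"]
  by (intro exI[of _ "S n"]) auto

text \<open>On a linear piece the maximum is attained at an endpoint. Index 0 cannot be the witness,
  since \<open>X 0 = 0 \<le> q\<close>.\<close>

lemma ex_less_X_if_less_telegraph_Q:
  assumes "ereal q < telegraph_Q c1 c2 V0 \<tau> \<omega>" "q \<ge> 0"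
  shows "\<exists>k\<ge>1. q < X k"
proof -
  obtain t where t: "t \<ge> 0" "q < telegraph_D c1 c2 V0 \<tau> t \<omega>"
    using assms by (auto simp: less_telegraph_Q_iff)
  \<comment> \<open>The first switching time after \<open>t\<close> closes the piece containing
    \<open>t\<close>; its index is positive because \<open>S 0 = 0 \<le> t\<close>.\<close>
  define N where "N = (LEAST n. t < S n)"
  have "\<exists>n. t < S n"
    using unbounded by (simp add: S_def)
  then have N: "t < S N" "\<And>n. n < N \<Longrightarrow> S n \<le> t"
    unfolding N_def by (auto intro: LeastI_ex dest: not_less_Least)
  then obtain n where n: "N = Suc n"
    using t by (cases N) (auto simp: S_0)
  have D: "telegraph_D c1 c2 V0 \<tau> t \<omega> = X n + v (Suc n) * (t - S n)"
    using N n by (intro telegraph_D_eq) auto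
  have XS: "X (Suc n) = X n + v (Suc n) * (S (Suc n) - S n)"
    by (simp add: X_def S_Suc)
  have "q < X n \<or> q < X (Suc n)"
  proof (cases "v (Suc n) \<ge> 0")
    case True
    then have "v (Suc n) * (t - S n) \<le> v (Suc n) * (S (Suc n) - S n)"
      using N n by (intro mult_left_mono) auto
    then show ?thesis
      using t D XS by linarith
  next
    case False
    then have "v (Suc n) * (t - S n) \<le> 0"
      using N(2)[of n] n by (intro mult_nonpos_nonneg) auto
    then show ?thesis
      using t D by linarith
  qed
  moreover have "X 0 = 0"
    by (simp add: X_def)
  ultimately show ?thesis
    using assms(2) by (cases n) (auto intro: exI[of _ "Suc _"] simp del: One_nat_def simp: Suc_le_eq)
qed

end

subsection \<open>Tail of the supremum\<close>

lemma alternating_exponentials_nonneg: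
  assumes "prob_space P" and alt: "alternating_exponentials P l m \<tau>" and "l > 0" "m > 0"
  shows "AE \<omega> in P. \<forall>i\<ge>1. 0 \<le> \<tau> i \<omega>"
proof -
  interpret prob_space P by fact
  have "AE \<omega> in P. i \<ge> 1 \<longrightarrow> 0 \<le> \<tau> i \<omega>" for i
  proof (cases "i \<ge> 1")
    case True
    then have "alternate l m i * real (Suc i div 2) > 0"
      using assms by (auto simp: alternate_def div_greater_zero_iff)
    from exponential_distributedD_gt[OF alternating_exponentials_distributed[OF alt True] _ this, of 0]
    have "AE \<omega> in P. \<omega> \<in> {\<omega> \<in> space P. 0 < \<tau> i \<omega>}"
      by (intro AE_prob_1) simp
    then show ?thesis
      by eventually_elim auto
  qed simp
  then show ?thesis
    by (simp add: AE_all_countable)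
qed

text \<open>After taking logarithms and dividing by \<open>q\<close>, the constants vanish in the
  limit. The lower bound has the exact rate, while upper bounds at all rates below \<open>r\<close>
  suffice for the limit.\<close>

lemma tendsto_log_exponential_decay:
  fixes f :: "real \<Rightarrow> real"
  assumes r: "r > 0" and K: "K > 0" and lower: "\<And>q. q > 0 \<Longrightarrow> K * exp (- (r * q)) \<le> f q"
    and upper: "\<And>\<theta>. 0 < \<theta> \<Longrightarrow> \<theta> < r \<Longrightarrow> \<exists>C. \<forall>q>0. f q \<le> C * exp (- (\<theta> * q))"
  shows "((\<lambda>q. 1 / q * ln (f q)) \<longlongrightarrow> - r) at_top"
proof (rule order_tendstoI)
  have f_pos: "f q > 0" if "q > 0" for q
    using lower[OF that] K by (meson exp_gt_zero less_le_trans mult_pos_pos)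
  have lim: "((\<lambda>q. ln c / q - s) \<longlongrightarrow> - s) at_top" for c s :: real
  proof -
    have "((\<lambda>q. ln c / q) \<longlongrightarrow> 0) at_top"
      by (intro tendsto_divide_0[OF tendsto_const] filterlim_at_top_imp_at_infinity filterlim_ident)
    from tendsto_diff[OF this tendsto_const[of s]] show ?thesis
      by simp
  qed
  fix a :: real
  {
    assume "a < - r"
    from order_tendstoD(1)[OF lim[of K r] this] eventually_gt_at_top[of 0]
    show "\<forall>\<^sub>F q in at_top. a < 1 / q * ln (f q)"
    proof eventually_elim
      case (elim q)
      have "ln (K * exp (- (r * q))) \<le> ln (f q)"
        using lower[OF elim(2)] f_pos[OF elim(2)] K by (subst ln_le_cancel_iff) auto
      then have "ln K - r * q \<le> ln (f q)"
        using K by (simp add: ln_mult)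
      then have "(ln K - r * q) / q \<le> ln (f q) / q"
        using elim(2) by (intro divide_right_mono) auto
      then have "ln K / q - r \<le> 1 / q * ln (f q)"
        using elim(2) by (simp add: diff_divide_distrib)
      with elim(1) show ?case
        by simp
    qed
  next
    assume a: "- r < a"
    \<comment> \<open>The midpoint of \<open>- a\<close> and \<open>r\<close> exceeds
      \<open>- a\<close>; the maximum with \<open>r / 2\<close> keeps the rate positive.\<close>
    define \<theta> where "\<theta> = max (r / 2) ((r - a) / 2)"
    have \<theta>: "0 < \<theta>" "\<theta> < r" "- \<theta> < a"
      using a r by (auto simp: \<theta>_def max_def field_simps)
    obtain C where C: "\<And>q. q > 0 \<Longrightarrow> f q \<le> C * exp (- (\<theta> * q))"
      using upper[OF \<theta>(1,2)] by blast
    have C_pos: "C > 0"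
      using C[of 1] f_pos[of 1] by (metis exp_gt_zero less_le_trans zero_less_mult_pos2 zero_less_one)
    from order_tendstoD(2)[OF lim[of C \<theta>] \<theta>(3)] eventually_gt_at_top[of 0]
    show "\<forall>\<^sub>F q in at_top. 1 / q * ln (f q) < a"
    proof eventually_elim
      case (elim q)
      have "ln (f q) \<le> ln (C * exp (- (\<theta> * q)))"
        using C[OF elim(2)] f_pos[OF elim(2)] C_pos by (subst ln_le_cancel_iff) auto
      then have "ln (f q) \<le> ln C - \<theta> * q"
        using C_pos by (simp add: ln_mult)
      then have "ln (f q) / q \<le> (ln C - \<theta> * q) / q"
        using elim(2) by (intro divide_right_mono) auto
      then have "1 / q * ln (f q) \<le> ln C / q - \<theta>"
        using elim(2) by (simp add: diff_divide_distrib)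
      with elim(1) show ?case
        by simp
    qed
  }
qed

section \<open>Conditioning on the initial velocity\<close>

context damped_telegraph
begin

abbreviation start :: "real \<Rightarrow> 'a set" where
  "start v0 \<equiv> {\<omega> \<in> space M. V0 \<omega> = v0}"

abbreviation Q_gt :: "real \<Rightarrow> 'a set" where
  "Q_gt q \<equiv> {\<omega> \<in> space M. ereal q < telegraph_Q c1 c2 V0 \<tau> \<omega>}"

lemma sets_start[measurable]: "start v0 \<in> sets M"
  using V0_rv by measurable

lemma sets_Q_gt[measurable]: "Q_gt q \<in> sets M"
  using sets_telegraph_Q_gt[OF \<tau>_rv V0_rv] .

lemma prob_space_start: "prob (start v0) > 0 \<Longrightarrow> prob_space (uniform_measure M (start v0))"
  by (intro prob_space_uniform_measure) (auto simp: emeasure_eq_measure)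

lemma measure_start:
  assumes "prob (start v0) > 0" "B \<in> sets M"
  shows "prob (B \<inter> start v0) = prob (start v0) * measure (uniform_measure M (start v0)) B"
  using assms by (subst measure_uniform_measure) (auto simp: emeasure_eq_measure Int_commute)

lemma AE_telegraph_path:
  assumes v0: "v0 = c1 \<or> v0 = - c2" and pos: "prob (start v0) > 0"
    and alt: "alternating_exponentials (uniform_measure M (start v0)) l m \<tau>"
    and lm: "l > 0" "m > 0"
  shows "AE \<omega> in uniform_measure M (start v0). telegraph_path c1 c2 V0 \<tau> \<omega> \<and> V0 \<omega> = v0"
proof -
  let ?P = "uniform_measure M (start v0)"
  have start: "AE \<omega> in ?P. V0 \<omega> = v0"
    by (rule AE_uniform_measureI) auto
  show ?thesis
    using start AE_space[of ?P]
      alternating_exponentials_nonneg[OF prob_space_start[OF pos] alt lm]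
      alternating_exponentials_sum_unbounded[OF prob_space_start[OF pos] alt lm]
  proof eventually_elim
    case (elim \<omega>)
    show ?case
    proof
      show "telegraph_path c1 c2 V0 \<tau> \<omega>"
        by unfold_locales
          (use elim v0 c1_pos c2_pos borel_measurable_telegraph_V_path[OF \<tau>_rv V0_rv] in auto)
    qed (rule elim)
  qed
qed

text \<open>Almost surely under the conditional law, a supremum above \<open>q\<close> forces a
  crossing at a switching time, to which the maximal inequality applies. The drift term is
  \<open>k\<close> times the mean displacement over the \<open>k\<close>-th pair of
  stretches.\<close>

lemma prob_Q_gt_start_upper:
  assumes v0: "v0 = c1 \<or> v0 = - c2"
    and alt: "prob (start v0) > 0 \<Longrightarrow> alternating_exponentials (uniform_measure M (start v0)) l m \<tau>"
    and lm: "l > 0" "m > 0" and drift: "v0 / l + (c1 - c2 - v0) / m < 0"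
    and \<theta>: "\<theta> > 0" "\<theta> * v0 < l" "\<theta> * (c1 - c2 - v0) < m"
  shows "\<exists>C. \<forall>q>0. prob (Q_gt q \<inter> start v0) \<le> C * exp (- (\<theta> * q))"
proof (cases "prob (start v0) > 0")
  case True
  let ?P = "uniform_measure M (start v0)"
  interpret P: prob_space ?P
    by (rule prob_space_start[OF True])
  define Y where "Y k \<omega> = (\<Sum>i=1..k. alternate v0 (c1 - c2 - v0) i * \<tau> i \<omega>)" for k \<omega>
  have [measurable]: "Y k \<in> borel_measurable M" for k
    unfolding Y_def by (intro borel_measurable_sum borel_measurable_times \<tau>_rv) auto
  obtain C where C: "\<And>q. measure ?P {\<omega> \<in> space ?P. \<exists>k\<ge>1. q < Y k \<omega>} \<le> C * exp (- (\<theta> * q))"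
    using alternating_exponentials_maximal[OF P.prob_space_axioms alt[OF True] lm drift \<theta>]
    unfolding Y_def by blast
  have "prob (Q_gt q \<inter> start v0) \<le> prob (start v0) * C * exp (- (\<theta> * q))" if q: "q > 0" for q
  proof -
    have "measure ?P (Q_gt q) \<le> measure ?P {\<omega> \<in> space ?P. \<exists>k\<ge>1. q < Y k \<omega>}"
    proof (rule P.finite_measure_mono_AE)
      show "AE \<omega> in ?P. \<omega> \<in> Q_gt q \<longrightarrow> \<omega> \<in> {\<omega> \<in> space ?P. \<exists>k\<ge>1. q < Y k \<omega>}"
        using AE_telegraph_path[OF v0 True alt[OF True] lm]
      proof eventually_elim
        case (elim \<omega>)
        then interpret telegraph_path c1 c2 V0 \<tau> \<omega>
          by simp
        show ?case
          using ex_less_X_if_less_telegraph_Q[of q] q elim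
          by (auto simp: Y_def telegraph_path.X_def[OF telegraph_path_axioms] v_def)
      qed
    qed measurable
    also note C
    finally show ?thesis
      using True by (simp add: measure_start mult.assoc)
  qed
  then show ?thesis
    by blast
next
  case False
  \<comment> \<open>For a null start nothing is known about the conditional law, but the
    intersection is null as well and \<open>C = 0\<close> works.\<close>
  then have "prob (start v0) = 0"
    by (simp add: zero_less_measure_iff)
  then have "prob (Q_gt q \<inter> start v0) \<le> 0" for q
    using finite_measure_mono[of "Q_gt q \<inter> start v0" "start v0"] by auto
  then show ?thesis
    by (intro exI[of _ 0]) simp
qed

text \<open>The supremum dominates the position at each switching time, so any event about the
  stretches that forces one such position above \<open>q\<close> bounds the tail from below.\<close>

lemma prob_Q_gt_start_lower:
  assumes v0: "v0 = c1 \<or> v0 = - c2" and pos: "prob (start v0) > 0"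
    and alt: "alternating_exponentials (uniform_measure M (start v0)) l m \<tau>"
    and lm: "l > 0" "m > 0"
    and B: "B \<in> sets M" "\<And>\<omega>. \<omega> \<in> B \<Longrightarrow> \<exists>n. q < (\<Sum>i=1..n. alternate v0 (c1 - c2 - v0) i * \<tau> i \<omega>)"
  shows "prob (Q_gt q \<inter> start v0) \<ge> prob (start v0) * measure (uniform_measure M (start v0)) B"
proof -
  let ?P = "uniform_measure M (start v0)"
  interpret P: prob_space ?P
    by (rule prob_space_start[OF pos])
  have "measure ?P B \<le> measure ?P (Q_gt q)"
  proof (rule P.finite_measure_mono_AE)
    show "AE \<omega> in ?P. \<omega> \<in> B \<longrightarrow> \<omega> \<in> Q_gt q"
      using AE_telegraph_path[OF v0 pos alt lm] AE_space[of ?P]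
    proof eventually_elim
      case (elim \<omega>)
      then interpret telegraph_path c1 c2 V0 \<tau> \<omega>
        by simp
      show ?case
        using less_telegraph_Q_if_less_X[of q] B(2)[of \<omega>] elim
        by (auto simp: telegraph_path.X_def[OF telegraph_path_axioms] v_def)
    qed
  qed measurable
  then show ?thesis
    using pos by (simp add: measure_start mult_left_mono)
qed

text \<open>One start of positive probability suffices. If \<open>\<alpha> = 0\<close> the path
  first moves down, but its second stretch is upward and again has rate \<open>l1\<close>.\<close>

lemma prob_Q_gt_lower:
  "\<exists>K>0. \<forall>q>0. K * exp (- (l1 / c1 * q)) \<le> prob (Q_gt q)"
proof (cases "\<alpha> = 0")
  case False
  then have pos: "prob (start c1) > 0"
    using prob_V0_c1 \<alpha>_range by simp
  let ?P = "uniform_measure M (start c1)"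
  interpret P: prob_space ?P
    by (rule prob_space_start[OF pos])
  note alt = given_c1[OF pos]
  have "prob (start c1) * exp (- (l1 / c1 * q)) \<le> prob (Q_gt q)" if q: "q > 0" for q
  proof -
    define B where "B = {\<omega> \<in> space M. q / c1 < \<tau> 1 \<omega>}"
    have "B \<in> sets M"
      unfolding B_def using \<tau>_rv[of 1] by measurable
    moreover have "\<exists>n. q < (\<Sum>i=1..n. alternate c1 (c1 - c2 - c1) i * \<tau> i \<omega>)" if "\<omega> \<in> B" for \<omega>
      using that c1_pos by (intro exI[of _ 1]) (auto simp: B_def alternate_def field_simps)
    ultimately have "prob (start c1) * measure ?P B \<le> prob (Q_gt q \<inter> start c1)"
      by (intro prob_Q_gt_start_lower[OF _ pos alt l1_pos l2_pos]) auto
    also have "\<dots> \<le> prob (Q_gt q)"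
      by (rule finite_measure_mono) auto
    finally show ?thesis
      using P.exponential_distributedD_gt[OF alternating_exponentials_distributed[OF alt, of 1], of "q / c1"]
        q c1_pos l1_pos by (simp add: B_def alternate_def mult.commute)
  qed
  then show ?thesis
    using pos by blast
next
  case True
  then have pos: "prob (start (- c2)) > 0"
    using prob_V0_c2 by simp
  let ?P = "uniform_measure M (start (- c2))"
  interpret P: prob_space ?P
    by (rule prob_space_start[OF pos])
  note alt = given_c2[OF pos]
  \<comment> \<open>\<open>1 - exp (- l2)\<close> is the probability that the downward stretch lasts
    at most 1, and \<open>exp (- (l1 * c2 / c1))\<close> is the price of regaining the at most
    \<open>c2\<close> lost in it.\<close>
  define K where "K = prob (start (- c2)) * ((1 - exp (- l2)) * exp (- (l1 * c2 / c1)))"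
  have "K * exp (- (l1 / c1 * q)) \<le> prob (Q_gt q)" if q: "q > 0" for q
  proof -
    \<comment> \<open>First stretch at most 1, second one long enough to climb
      \<open>q + c2\<close>.\<close>
    define A where "A i = (if i = 1 then {..1} else {(q + c2) / c1<..})" for i :: nat
    define B where "B = (\<Inter>i\<in>{1,2}. \<tau> i -` A i \<inter> space M)"
    have "\<tau> i -` A i \<inter> space M \<in> sets M" if "i \<ge> 1" for i
      by (rule measurable_sets[OF \<tau>_rv[OF that]]) (simp add: A_def)
    then have "B \<in> sets M"
      unfolding B_def by auto
    moreover have "\<exists>n. q < (\<Sum>i=1..n. alternate (- c2) (c1 - c2 - - c2) i * \<tau> i \<omega>)" if "\<omega> \<in> B" for \<omega>
    proof -
      have *: "\<tau> 1 \<omega> \<le> 1" "(q + c2) / c1 < \<tau> 2 \<omega>"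
        using that by (auto simp: B_def A_def)
      have "c2 * \<tau> 1 \<omega> \<le> c2 * 1"
        using * c2_pos by (intro mult_left_mono) auto
      moreover have "q + c2 < c1 * \<tau> 2 \<omega>"
        using * c1_pos by (simp add: field_simps)
      ultimately show ?thesis
        by (intro exI[of _ 2]) (simp add: alternate_def numeral_2_eq_2)
    qed
    ultimately have "prob (start (- c2)) * measure ?P B \<le> prob (Q_gt q \<inter> start (- c2))"
      by (intro prob_Q_gt_start_lower[OF _ pos alt l2_pos l1_pos]) auto
    also have "\<dots> \<le> prob (Q_gt q)"
      by (rule finite_measure_mono) auto
    finally have le: "prob (start (- c2)) * measure ?P B \<le> prob (Q_gt q)" .
    have "measure ?P B = (\<Prod>i\<in>{1,2}. measure ?P (\<tau> i -` A i \<inter> space ?P))"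
      unfolding B_def using alt
      by (subst P.indep_varsD[symmetric, where I = "{1..}" and M' = "\<lambda>_. borel"])
        (auto simp: alternating_exponentials_def A_def)
    also have "\<dots> = measure ?P {\<omega> \<in> space ?P. \<tau> 1 \<omega> \<le> 1} * measure ?P {\<omega> \<in> space ?P. (q + c2) / c1 < \<tau> 2 \<omega>}"
      by (simp add: A_def vimage_def Int_def conj_commute)
    also have "\<dots> = (1 - exp (- l2)) * exp (- ((q + c2) / c1 * l1))"
      using P.exponential_distributedD_le[OF alternating_exponentials_distributed[OF alt, of 1], of 1]
        P.exponential_distributedD_gt[OF alternating_exponentials_distributed[OF alt, of 2], of "(q + c2) / c1"]
        q c1_pos c2_pos l1_pos l2_pos
      by (simp add: alternate_def)
    also have "exp (- ((q + c2) / c1 * l1)) = exp (- (l1 * c2 / c1)) * exp (- (l1 / c1 * q))"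
      using c1_pos by (simp add: exp_add[symmetric] field_simps)
    finally show ?thesis
      using le by (simp add: K_def mult.assoc)
  qed
  moreover have "K > 0"
    using pos l2_pos by (simp add: K_def)
  ultimately show ?thesis
    by blast
qed

text \<open>The two starts carry all the mass, and for both of them the drift of a pair is
  \<open>c1 / l1 - c2 / l2 < 0\<close>. The upward velocity meets rate \<open>l1\<close> in either
  case, whence the bound on \<open>\<theta>\<close>.\<close>

lemma prob_Q_gt_upper:
  assumes drift: "l2 * c1 - l1 * c2 < 0" and \<theta>: "0 < \<theta>" "\<theta> < l1 / c1"
  shows "\<exists>C. \<forall>q>0. prob (Q_gt q) \<le> C * exp (- (\<theta> * q))"
proof -
  have *: "\<theta> * c1 < l1" "\<theta> * - c2 < l2"
    using \<theta> c1_pos c2_pos l2_pos by (auto simp: field_simps intro: order_less_trans[of _ 0] add_pos_pos)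
  obtain C1 where C1: "\<And>q. q > 0 \<Longrightarrow> prob (Q_gt q \<inter> start c1) \<le> C1 * exp (- (\<theta> * q))"
    using prob_Q_gt_start_upper[of c1 l1 l2 \<theta>] given_c1 drift \<theta>(1) * l1_pos l2_pos
    by (auto simp: field_simps)
  obtain C2 where C2: "\<And>q. q > 0 \<Longrightarrow> prob (Q_gt q \<inter> start (- c2)) \<le> C2 * exp (- (\<theta> * q))"
    using prob_Q_gt_start_upper[of "- c2" l2 l1 \<theta>] given_c2 drift \<theta>(1) * l1_pos l2_pos
    by (auto simp: field_simps)
  \<comment> \<open>The starts are disjoint because \<open>- c2 < 0 < c1\<close>, and their
    probabilities \<open>\<alpha>\<close> and \<open>1 - \<alpha>\<close> add up to 1.\<close>
  have "prob (start c1 \<union> start (- c2)) = 1"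
    using c1_pos c2_pos prob_V0_c1 prob_V0_c2 by (subst finite_measure_Union) auto
  then have "AE \<omega> in M. \<omega> \<in> start c1 \<union> start (- c2)"
    by (rule AE_prob_1)
  then have split: "prob (Q_gt q) \<le> prob ((Q_gt q \<inter> start c1) \<union> (Q_gt q \<inter> start (- c2)))" for q
    by (intro finite_measure_mono_AE) (auto elim: eventually_mono)
  have "prob (Q_gt q) \<le> (C1 + C2) * exp (- (\<theta> * q))" if "q > 0" for q
    using order_trans[OF split[of q] measure_Un_le[of "Q_gt q \<inter> start c1" M "Q_gt q \<inter> start (- c2)"]]
      C1[OF that] C2[OF that] by (simp add: distrib_right)
  then show ?thesis
    by blast
qed

end

theorem proposition4p2:
  fixes M :: "'a measure" and l1 l2 c1 c2 \<alpha> :: real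
    and V0 :: "'a \<Rightarrow> real" and \<tau> :: "nat \<Rightarrow> 'a \<Rightarrow> real"
  assumes "damped_telegraph M l1 l2 c1 c2 \<alpha> V0 \<tau>"
    and "l2 * c1 - l1 * c2 < 0"
  shows "((\<lambda>q::real. 1 / q * ln (measure M {\<omega> \<in> space M. telegraph_Q c1 c2 V0 \<tau> \<omega> > ereal q}))
           \<longlongrightarrow> - l1 / c1) at_top"
proof -
  interpret damped_telegraph M l1 l2 c1 c2 \<alpha> V0 \<tau> by fact
  obtain K where "K > 0" "\<And>q. q > 0 \<Longrightarrow> K * exp (- (l1 / c1 * q)) \<le> prob (Q_gt q)"
    using prob_Q_gt_lower by blast
  then have "((\<lambda>q. 1 / q * ln (prob (Q_gt q))) \<longlongrightarrow> - (l1 / c1)) at_top"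
    using prob_Q_gt_upper[OF assms(2)] l1_pos c1_pos
    by (intro tendsto_log_exponential_decay) auto
  then show ?thesis
    by simp
qed

end
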